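(* Let $R$ be a transit function on a finite non-empty set $V$ satisfying $(Ch)$. Then the $R$-convexity $\mathcal{C}_R$ is a convex geometry if and only if $R$ satisfies $(b1)$ and $(J0)$.
   Context: A transit function on a finite non-empty set $V$ is a map $R:V\times V\to 2^V$ such that $u\in R(u,v)$, $R(u,v)=R(v,u)$ and $R(u,u)=\{u\}$ for all $u,v\in V$. A convexity on the finite set $V$ is a family of subsets of $V$ (called convex sets) containing $\emptyset$ and $V$ and closed under intersections; the convex hull of $A\subseteq V$ is the smallest convex set containing $A$. A set $S\subseteq V$ is $R$-convex if $R(u,v)\subseteq S$ for all $u,v\in S$; $\mathcal{C}_R$ denotes the convexity of all $R$-convex subsets of $V$. A point $k$ of a convex set $K$ is an extreme point of $K$ if $K\setminus\{k\}$ is convex. A convexity is a convex geometry if every convex set $K$ is the convex hull of the set of extreme points of $K$. Axioms on $R$: - $(Ch)$: for all $u,v,w,x,y\in V$ (not necessarily distinct), if $x\in R(u,v)$ and $y\in R(x,w)$, then $y\in R(u,w)$ or $y\in R(v,w)$ or $y\in R(u,v)$. - $(b1)$: for all $u,v,x\in V$, if $x\in R(u,v)$ and $x\neq v$, then $v\notin R(u,x)$. - $(J0)$: for all pairwise distinct $u,v,x,y\in V$, if $x\in R(u,y)$ and $y\in R(x,v)$, then $x\in R(u,v)$. *)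

theory Defs
  imports Main "HOL.Hull"
begin

definition transit_function :: "'a set \<Rightarrow> ('a \<Rightarrow> 'a \<Rightarrow> 'a set) \<Rightarrow> bool" where
  "transit_function V R \<longleftrightarrow>
     (\<forall>u\<in>V. \<forall>v\<in>V. R u v \<subseteq> V \<and> u \<in> R u v \<and> R u v = R v u) \<and>
     (\<forall>u\<in>V. R u u = {u})"

definition convexity :: "'a set \<Rightarrow> 'a set set \<Rightarrow> bool" where
  "convexity V \<C> \<longleftrightarrow>
     \<C> \<subseteq> Pow V \<and> {} \<in> \<C> \<and> V \<in> \<C> \<and>
     (\<forall>\<D>. \<D> \<subseteq> \<C> \<and> \<D> \<noteq> {} \<longrightarrow> \<Inter>\<D> \<in> \<C>)"

text \<open>The library operator \<open>hull\<close> intersects all members of the family that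
  contain \<open>A\<close>; for a convexity on \<open>V\<close> and \<open>A \<subseteq> V\<close> this is the smallest such member.\<close>

definition convexity_hull :: "'a set set \<Rightarrow> 'a set \<Rightarrow> 'a set" where
  "convexity_hull \<C> A = (\<lambda>K. K \<in> \<C>) hull A"

definition extreme_points :: "'a set set \<Rightarrow> 'a set \<Rightarrow> 'a set" where
  "extreme_points \<C> K = {k \<in> K. K - {k} \<in> \<C>}"

definition convex_geometry :: "'a set \<Rightarrow> 'a set set \<Rightarrow> bool" where
  "convex_geometry V \<C> \<longleftrightarrow>
     convexity V \<C> \<and> (\<forall>K\<in>\<C>. K = convexity_hull \<C> (extreme_points \<C> K))"

definition R_convex_sets :: "'a set \<Rightarrow> ('a \<Rightarrow> 'a \<Rightarrow> 'a set) \<Rightarrow> 'a set set" where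
  "R_convex_sets V R = {S. S \<subseteq> V \<and> (\<forall>u\<in>S. \<forall>v\<in>S. R u v \<subseteq> S)}"

definition axiom_Ch :: "'a set \<Rightarrow> ('a \<Rightarrow> 'a \<Rightarrow> 'a set) \<Rightarrow> bool" where
  "axiom_Ch V R \<longleftrightarrow>
     (\<forall>u\<in>V. \<forall>v\<in>V. \<forall>w\<in>V. \<forall>x\<in>V. \<forall>y\<in>V.
        x \<in> R u v \<and> y \<in> R x w \<longrightarrow> y \<in> R u w \<or> y \<in> R v w \<or> y \<in> R u v)"

definition axiom_b1 :: "'a set \<Rightarrow> ('a \<Rightarrow> 'a \<Rightarrow> 'a set) \<Rightarrow> bool" where
  "axiom_b1 V R \<longleftrightarrow>
     (\<forall>u\<in>V. \<forall>v\<in>V. \<forall>x\<in>V. x \<in> R u v \<and> x \<noteq> v \<longrightarrow> v \<notin> R u x)"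

definition axiom_J0 :: "'a set \<Rightarrow> ('a \<Rightarrow> 'a \<Rightarrow> 'a set) \<Rightarrow> bool" where
  "axiom_J0 V R \<longleftrightarrow>
     (\<forall>u\<in>V. \<forall>v\<in>V. \<forall>x\<in>V. \<forall>y\<in>V.
        distinct [u, v, x, y] \<and> x \<in> R u y \<and> y \<in> R x v \<longrightarrow> x \<in> R u v)"

end

theory Submission
  imports Defs
begin

text \<open>
  Under \<open>(Ch)\<close> the hull of \<open>A\<close> is the union of the sets \<open>R a b\<close> with \<open>a, b \<in> A\<close>. A violation of
  \<open>(b1)\<close> or \<open>(J0)\<close> yields a convex set with two generating sets whose intersection is too
  small to generate it, although every generating set contains all extreme points. Conversely,
  if \<open>a\<close> is a member of a minimal generating set \<open>A\<close> of \<open>K\<close> and \<open>a \<in> R p q\<close> with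
  \<open>p, q \<in> K - {a}\<close>, then \<open>(b1)\<close> and \<open>(J0)\<close> push \<open>p\<close> and \<open>q\<close> along segments ending in \<open>a\<close> into
  the hull of \<open>A - {a}\<close>, which then contains \<open>a\<close>, against minimality; so all members of \<open>A\<close>
  are extreme.
\<close>

section \<open>Convex sets, hulls and generating sets\<close>

locale transit =
  fixes V :: "'a set" and R :: "'a \<Rightarrow> 'a \<Rightarrow> 'a set"
  assumes transit: "transit_function V R"
begin

abbreviation convex :: "'a set \<Rightarrow> bool" where
  "convex S \<equiv> S \<in> R_convex_sets V R"

abbreviation conv :: "'a set \<Rightarrow> 'a set" where
  "conv A \<equiv> convexity_hull (R_convex_sets V R) A"

lemma R_subset: "u \<in> V \<Longrightarrow> v \<in> V \<Longrightarrow> R u v \<subseteq> V"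
  and left_mem: "u \<in> V \<Longrightarrow> v \<in> V \<Longrightarrow> u \<in> R u v"
  and R_sym: "u \<in> V \<Longrightarrow> v \<in> V \<Longrightarrow> R u v = R v u"
  and R_refl: "u \<in> V \<Longrightarrow> R u u = {u}"
  using transit unfolding transit_function_def by blast+

lemma right_mem: "u \<in> V \<Longrightarrow> v \<in> V \<Longrightarrow> v \<in> R u v"
  using left_mem R_sym by blast

lemma convexI: "S \<subseteq> V \<Longrightarrow> (\<And>u v. u \<in> S \<Longrightarrow> v \<in> S \<Longrightarrow> R u v \<subseteq> S) \<Longrightarrow> convex S"
  by (simp add: R_convex_sets_def)

lemma convex_subset: "convex S \<Longrightarrow> S \<subseteq> V"
  by (simp add: R_convex_sets_def)

lemma convexD: "convex S \<Longrightarrow> u \<in> S \<Longrightarrow> v \<in> S \<Longrightarrow> R u v \<subseteq> S"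
  by (simp add: R_convex_sets_def)

lemma convex_singleton: "u \<in> V \<Longrightarrow> convex {u}"
  by (rule convexI) (auto simp: R_refl)

lemma convexity_R_convex_sets: "convexity V (R_convex_sets V R)"
  unfolding convexity_def
proof (intro conjI allI impI)
  fix \<D> assume \<D>: "\<D> \<subseteq> R_convex_sets V R \<and> \<D> \<noteq> {}"
  then show "convex (\<Inter>\<D>)"
    by (intro convexI) (use convexD convex_subset in blast)+
qed (use R_subset in \<open>auto simp: R_convex_sets_def\<close>)

lemma conv_superset: "A \<subseteq> conv A"
  unfolding convexity_hull_def by (rule hull_subset)

lemma conv_minimal: "A \<subseteq> K \<Longrightarrow> convex K \<Longrightarrow> conv A \<subseteq> K"
  unfolding convexity_hull_def by (rule hull_minimal)

lemma conv_mono: "A \<subseteq> B \<Longrightarrow> conv A \<subseteq> conv B"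
  unfolding convexity_hull_def by (rule hull_mono)

lemma conv_self: "convex K \<Longrightarrow> conv K = K"
  using conv_superset conv_minimal by blast

lemma convex_conv:
  assumes "A \<subseteq> V" shows "convex (conv A)"
proof -
  \<comment> \<open>\<open>V\<close> is a member, and closure under intersections is available only
    for non-empty families.\<close>
  have "{K. convex K \<and> A \<subseteq> K} \<noteq> {}"
    using assms convexity_R_convex_sets by (auto simp: convexity_def)
  then show ?thesis
    using convexity_R_convex_sets unfolding convexity_def convexity_hull_def hull_def by auto
qed

text \<open>If \<open>A\<close> missed an extreme point \<open>e\<close>, the convex set
  \<open>K - {e}\<close> would contain \<open>A\<close> and hence \<open>conv A\<close>.\<close>

lemma extreme_points_subset_generators:
  assumes "A \<subseteq> K" and "K \<subseteq> conv A"
  shows "extreme_points (R_convex_sets V R) K \<subseteq> A"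
proof
  fix e assume "e \<in> extreme_points (R_convex_sets V R) K"
  then have "e \<in> K" "convex (K - {e})" by (auto simp: extreme_points_def)
  then show "e \<in> A"
    using assms conv_minimal[of A "K - {e}"] by auto
qed

text \<open>Both generating sets contain the extreme points, which already generate
  \<open>K\<close>. This is the only consequence of being a convex geometry used to derive the two
  axioms.\<close>

lemma generators_inter:
  assumes "convex_geometry V (R_convex_sets V R)" and "convex K"
    and "A \<subseteq> K" "K \<subseteq> conv A" "B \<subseteq> K" "K \<subseteq> conv B"
  shows "K \<subseteq> conv (A \<inter> B)"
proof -
  have "extreme_points (R_convex_sets V R) K \<subseteq> A \<inter> B"
    using extreme_points_subset_generators assms by simp
  moreover have "K = conv (extreme_points (R_convex_sets V R) K)"
    using assms by (auto simp: convex_geometry_def)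
  ultimately show ?thesis using conv_mono by metis
qed

end

section \<open>Hulls under \<open>(Ch)\<close>\<close>

locale Ch_transit = transit +
  assumes Ch: "axiom_Ch V R"
begin

lemma ChD:
  assumes "x \<in> R u v" "y \<in> R x w" "u \<in> V" "v \<in> V" "w \<in> V"
  shows "y \<in> R u w \<or> y \<in> R v w \<or> y \<in> R u v"
proof -
  have "x \<in> V" using assms R_subset by blast
  moreover have "y \<in> V" using assms R_subset \<open>x \<in> V\<close> by blast
  ultimately show ?thesis using Ch assms unfolding axiom_Ch_def by blast
qed

text \<open>The union is already convex: \<open>(Ch)\<close> trades an endpoint lying on a segment
  for the ends of that segment, and doing so at both endpoints leaves only segments between members
  of \<open>A\<close>.\<close>

lemma conv_eq_Union:
  assumes "A \<subseteq> V"
  shows "conv A = (\<Union>a\<in>A. \<Union>b\<in>A. R a b)" (is "_ = ?U")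
proof
  have "convex ?U"
  proof (rule convexI)
    show "?U \<subseteq> V" using assms R_subset by blast
    fix p q assume "p \<in> ?U" "q \<in> ?U"
    then obtain a b c d where abcd: "a \<in> A" "b \<in> A" "p \<in> R a b" "c \<in> A" "d \<in> A" "q \<in> R c d"
      by blast
    have q: "q \<in> V" using abcd assms R_subset by blast
    \<comment> \<open>This treats the endpoint \<open>q\<close>; below, \<open>(Ch)\<close> first
      replaces \<open>p\<close> by \<open>a\<close> or \<open>b\<close>, which are members of
      \<open>A\<close>.\<close>
    have seg: "R q e \<subseteq> ?U" if "e \<in> A" for e
    proof
      fix z assume "z \<in> R q e"
      then have "z \<in> R c e \<or> z \<in> R d e \<or> z \<in> R c d"
        using ChD[OF abcd(6)] that assms abcd(4,5) by blast
      then show "z \<in> ?U" using that abcd(4,5) by blast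
    qed
    show "R p q \<subseteq> ?U"
    proof
      fix z assume "z \<in> R p q"
      then have "z \<in> R a q \<or> z \<in> R b q \<or> z \<in> R a b"
        using ChD[OF abcd(3)] assms abcd(1,2) q by blast
      moreover have "R a q = R q a" "R b q = R q b" using R_sym assms abcd(1,2) q by blast+
      ultimately show "z \<in> ?U" using seg[OF abcd(1)] seg[OF abcd(2)] abcd(1,2) by blast
    qed
  qed
  moreover have "A \<subseteq> ?U" using assms left_mem by blast
  ultimately show "conv A \<subseteq> ?U" by (rule conv_minimal[rotated])
  show "?U \<subseteq> conv A"
    using convexD[OF convex_conv[OF assms]] conv_superset[of A] by blast
qed

lemma conv_pair:
  assumes "u \<in> V" "v \<in> V" shows "conv {u, v} = R u v"
  using assms conv_eq_Union[of "{u, v}"] R_refl R_sym left_mem right_mem by auto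

lemma convex_R: "u \<in> V \<Longrightarrow> v \<in> V \<Longrightarrow> convex (R u v)"
  using convex_conv[of "{u, v}"] conv_pair by simp

section \<open>From convex geometry to the axioms\<close>

text \<open>In a violation, \<open>{u, v}\<close> and \<open>{u, x}\<close> both generate
  \<open>R u v\<close>, yet they meet in \<open>{u}\<close>, which is its own hull.\<close>

lemma b1_if_convex_geometry:
  assumes "convex_geometry V (R_convex_sets V R)"
  shows "axiom_b1 V R"
  unfolding axiom_b1_def
proof (intro ballI impI notI)
  fix u v x assume uvx: "u \<in> V" "v \<in> V" "x \<in> V" "x \<in> R u v \<and> x \<noteq> v" "v \<in> R u x"
  have "R u v \<subseteq> R u x"
    using convexD[OF convex_R] uvx left_mem by blast
  then have "R u v \<subseteq> conv ({u, v} \<inter> {u, x})"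
    using uvx left_mem right_mem
    by (intro generators_inter assms convex_R) (auto simp: conv_pair)
  also have "{u, v} \<inter> {u, x} = {u}" using uvx by auto
  also have "conv {u} = {u}" using uvx conv_self convex_singleton by blast
  finally have "v = u" "x = u" using uvx right_mem by auto
  then show False using uvx by simp
qed

lemma J0_if_convex_geometry:
  assumes "convex_geometry V (R_convex_sets V R)"
  shows "axiom_J0 V R"
  unfolding axiom_J0_def
proof (intro ballI impI)
  fix u v x y
  assume V: "u \<in> V" "v \<in> V" "x \<in> V" "y \<in> V"
    and J: "distinct [u, v, x, y] \<and> x \<in> R u y \<and> y \<in> R x v"
  define K where "K = conv {u, v, x, y}"
  \<comment> \<open>Given \<open>u\<close> and \<open>v\<close>, each of \<open>x\<close> and
    \<open>y\<close> produces the other: \<open>y\<close> lies in \<open>R x v\<close> and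
    \<open>x\<close> in \<open>R u y\<close>. So \<open>{u, v, x}\<close> and
    \<open>{u, v, y}\<close> both generate \<open>K\<close>.\<close>
  have K: "K \<subseteq> conv A" if "{u, v} \<subseteq> A" "A \<subseteq> V" "x \<in> A \<or> y \<in> A" for A
  proof -
    have A: "convex (conv A)" "A \<subseteq> conv A" using that convex_conv conv_superset by auto
    have "R x v \<subseteq> conv A" if "x \<in> A"
      using that \<open>{u, v} \<subseteq> A\<close> A by (intro convexD) auto
    moreover have "R u y \<subseteq> conv A" if "y \<in> A"
      using that \<open>{u, v} \<subseteq> A\<close> A by (intro convexD) auto
    ultimately have "x \<in> conv A" "y \<in> conv A" using that(3) J A(2) by auto
    then show ?thesis unfolding K_def using A that by (intro conv_minimal) auto
  qed
  have sub: "{u, v, x, y} \<subseteq> K" unfolding K_def by (rule conv_superset)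
  have "K \<subseteq> conv ({u, v, x} \<inter> {u, v, y})"
  proof (rule generators_inter[OF assms])
    show "convex K" unfolding K_def using V by (intro convex_conv) simp
  qed (use K V sub in auto)
  also have "{u, v, x} \<inter> {u, v, y} = {u, v}" using J by auto
  also have "conv {u, v} = R u v" using V by (simp add: conv_pair)
  finally show "x \<in> R u v" using sub by blast
qed

section \<open>From the axioms to convex geometry\<close>

text \<open>Moves the endpoint \<open>p\<close> back to \<open>b\<close>. In the generic case
  \<open>(J0)\<close> puts \<open>p\<close> into the convex set \<open>R b q\<close>, which then
  contains \<open>R p q\<close>; \<open>(b1)\<close> excludes \<open>b = q\<close>.\<close>

lemma segment_extension:
  assumes b1: "axiom_b1 V R" and J0: "axiom_J0 V R"
    and V: "a \<in> V" "b \<in> V" "q \<in> V"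
    and p: "p \<in> R b a" "p \<noteq> a" and a: "a \<in> R p q"
  shows "a \<in> R b q"
proof -
  have pV: "p \<in> V" using p V R_subset by blast
  have "b \<noteq> a" using p V R_refl by blast
  then consider "q = a" | "p = q" | "p = b" | "b = q" | "distinct [b, q, p, a]"
    using p by auto
  then show ?thesis
  proof cases
    case 1 then show ?thesis using V right_mem by blast
  next
    case 2 then show ?thesis using a p(2) R_refl[OF pV] by simp
  next
    case 3 then show ?thesis using a by simp
  next
    case 4
    then have "a \<notin> R b p" using b1 p V pV unfolding axiom_b1_def by blast
    then show ?thesis using 4 a V pV R_sym by blast
  next
    case 5
    then have "p \<in> R b q" using J0 p a V pV unfolding axiom_J0_def by blast
    then show ?thesis
      using convexD[OF convex_R[of b q]] right_mem V a by blast
  qed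
qed

lemma extreme_point_if_irredundant:
  assumes b1: "axiom_b1 V R" and J0: "axiom_J0 V R"
    and A: "A \<subseteq> V" "a \<in> A" and irr: "a \<notin> conv (A - {a})"
  shows "a \<in> extreme_points (R_convex_sets V R) (conv A)"
proof -
  let ?C = "conv (A - {a})"
  have C: "convex ?C" "A - {a} \<subseteq> ?C"
    using A by (auto intro!: convex_conv conv_superset)
  have CV: "?C \<subseteq> V" using C(1) by (rule convex_subset)
  have K: "convex (conv A)" "conv A \<subseteq> V"
    using A(1) convex_conv convex_subset by simp_all
  have aV: "a \<in> V" using A by blast
  \<comment> \<open>By the union formula \<open>p\<close> lies on a segment between members of
    \<open>A\<close>. If one end is \<open>a\<close>, the other serves as \<open>b\<close>;
    otherwise \<open>p\<close> is in \<open>?C\<close> and \<open>b = p\<close> works.\<close>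
  have proj: "\<exists>b\<in>?C. p \<in> R b a" if p: "p \<in> conv A" "p \<noteq> a" for p
  proof -
    obtain c d where cd: "c \<in> A" "d \<in> A" "p \<in> R c d"
      using p(1) conv_eq_Union[OF A(1)] by blast
    show ?thesis
    proof (cases "c = a \<or> d = a")
      case True
      then obtain b where b: "b \<in> A" "p \<in> R b a"
        using cd R_sym[OF aV, of d] A by blast
      then have "b \<noteq> a" using p(2) R_refl[OF aV] by auto
      then show ?thesis using b C(2) by blast
    next
      case False
      then have "c \<in> ?C" "d \<in> ?C" using cd C(2) by auto
      then have "p \<in> ?C" using convexD[OF C(1)] cd(3) by blast
      then show ?thesis using left_mem[OF _ aV] CV by blast
    qed
  qed
  have "convex (conv A - {a})"
  proof (rule convexI)
    show "conv A - {a} \<subseteq> V" using K(2) by blast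
    fix p q assume pq: "p \<in> conv A - {a}" "q \<in> conv A - {a}"
    have pqV: "p \<in> V" "q \<in> V" using pq K(2) by auto
    have "a \<notin> R p q"
    proof
      assume a: "a \<in> R p q"
      obtain b c where bc: "b \<in> ?C" "p \<in> R b a" "c \<in> ?C" "q \<in> R c a" using proj pq by blast
      have bcV: "b \<in> V" "c \<in> V" using bc CV by auto
      \<comment> \<open>Both ends are moved in turn, \<open>p\<close> to \<open>b\<close> and then
        \<open>q\<close> to \<open>c\<close>, which places \<open>a\<close> in the hull of the other
        generators.\<close>
      have "a \<in> R b q"
        using segment_extension[OF b1 J0 aV bcV(1) pqV(2) bc(2) _ a] pq by simp
      then have "a \<in> R q b" using R_sym bcV pqV by blast
      then have "a \<in> R c b"
        using segment_extension[OF b1 J0 aV bcV(2) bcV(1) bc(4)] pq by simp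
      then show False using convexD[OF C(1) bc(3,1)] irr by blast
    qed
    then show "R p q \<subseteq> conv A - {a}"
      using convexD[OF K(1), of p q] pq by blast
  qed
  then show ?thesis using A(2) conv_superset[of A] by (auto simp: extreme_points_def)
qed

lemma convex_geometry_if_b1_J0:
  assumes "finite V" and b1: "axiom_b1 V R" and J0: "axiom_J0 V R"
  shows "convex_geometry V (R_convex_sets V R)"
  unfolding convex_geometry_def
proof (intro conjI ballI convexity_R_convex_sets)
  fix K assume K: "convex K"
  have KV: "K \<subseteq> V" using K by (rule convex_subset)
  \<comment> \<open>Finiteness of \<open>V\<close> yields an inclusion-minimal generating set; no
    member of it lies in the hull of the others, so all are extreme.\<close>
  let ?\<G> = "{A. A \<subseteq> K \<and> conv A = K}"
  have "finite ?\<G>" by (rule finite_subset[of _ "Pow K"]) (use assms KV finite_subset in auto)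
  moreover have "?\<G> \<noteq> {}" using conv_self[OF K] by blast
  ultimately have "\<exists>A\<in>?\<G>. \<forall>B\<in>?\<G>. B \<subseteq> A \<longrightarrow> A = B"
    by (rule finite_has_minimal)
  then obtain A where "A \<in> ?\<G>" and min: "\<forall>B\<in>?\<G>. B \<subseteq> A \<longrightarrow> A = B" ..
  then have A: "A \<subseteq> K" "conv A = K" by simp_all
  have "a \<in> extreme_points (R_convex_sets V R) K" if "a \<in> A" for a
  proof -
    have "a \<notin> conv (A - {a})"
    proof
      assume a: "a \<in> conv (A - {a})"
      have "convex (conv (A - {a}))" using A KV by (intro convex_conv) auto
      moreover have "A \<subseteq> conv (A - {a})" using a conv_superset[of "A - {a}"] by blast
      ultimately have "K \<subseteq> conv (A - {a})" using A conv_minimal by blast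
      then have "conv (A - {a}) = K" using A conv_mono[of "A - {a}" A] by blast
      then have "A = A - {a}" using min A(1) by simp blast
      then show False using that by blast
    qed
    then show ?thesis
      using extreme_point_if_irredundant[OF b1 J0, of A a] A KV that by auto
  qed
  then have "K \<subseteq> conv (extreme_points (R_convex_sets V R) K)"
    using conv_mono[of A] A by blast
  moreover have "conv (extreme_points (R_convex_sets V R) K) \<subseteq> K"
    using K by (intro conv_minimal) (auto simp: extreme_points_def)
  ultimately show "K = conv (extreme_points (R_convex_sets V R) K)" by blast
qed

end

theorem theorem2p10:
  fixes V :: "'a set" and R :: "'a \<Rightarrow> 'a \<Rightarrow> 'a set"
  assumes "finite V" and "V \<noteq> {}"
    and "transit_function V R"
    and "axiom_Ch V R"
  shows "convex_geometry V (R_convex_sets V R) \<longleftrightarrow> axiom_b1 V R \<and> axiom_J0 V R"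
proof -
  interpret Ch_transit V R
    by unfold_locales (fact assms)+
  show ?thesis
    using b1_if_convex_geometry J0_if_convex_geometry convex_geometry_if_b1_J0 assms(1) by blast
qed

end
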